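(* Let $A(t),B(t)\in\mathbb{R}[\cos(t),\sin(t)]$. The equation $x'=A(t)x^3+B(t)x^2$ has two different non-trivial invariant curves if and only if there exist $G(t),\hat G(t),S_1(t)\in\mathbb{R}[\cos(t),\sin(t)]$, with $\hat G$ not identically zero, and $k\in\mathbb{R}\setminus\{0\}$ such that $G(t)\neq0$, $S_1(t)\neq0$ and $S_1(t)+k\hat G(t)\neq0$ for all $t\in\mathbb{R}$, every irreducible factor of $\hat G(t)$ divides $G(t)$, and \[A(t)=G(t)S_1(t)\bigl(S_1(t)+k\hat G(t)\bigr)\left(G'(t)+\frac{G(t)\hat G'(t)}{\hat G(t)}\right),\] \[B(t)=-\bigl(G(t)S_1(t)\bigr)'-\bigl(S_1(t)+k\hat G(t)\bigr)\left(G'(t)+\frac{G(t)\hat G'(t)}{\hat G(t)}\right).\] Furthermore, in this case the two different invariant curves are \[1-G(t)S_1(t)x=0\quad\text{and}\quad 1-G(t)\bigl(S_1(t)+k\hat G(t)\bigr)x=0.\]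
   Context: $\mathbb{R}[\cos(t),\sin(t)]$ is the ring of real trigonometric polynomials; its units are the non-zero constants, and every non-zero non-unit is a finite product of irreducible elements. For the equation $x'=A(t)x^3+B(t)x^2$ put $\mathcal{X}=\frac{\partial}{\partial t}+(A(t)x^3+B(t)x^2)\frac{\partial}{\partial x}$. An invariant curve of the equation here means a curve $f(t,x)=0$ with $f(t,x)=Q(t)-P(t)x$, where $P,Q\in\mathbb{R}[\cos(t),\sin(t)]$, $P(t)\neq0$ for all $t\in\mathbb{R}$, $Q(t)-P(t)x$ is irreducible in $\mathbb{R}[\cos(t),\sin(t)][x]$ (i.e. $P$ and $Q$ have no common non-unit factor), and there is a continuous function $K(t,x)$ on $\mathbb{R}^2$ with $\mathcal{X}f=Kf$. It is non-trivial if $Q\neq0$, i.e. if it is not the curve $x=0$. *)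

theory Defs
  imports "HOL-Analysis.Analysis" "HOL-Computational_Algebra.Computational_Algebra"
begin

inductive_set trig_fun :: "(real \<Rightarrow> real) set" where
  const: "(\<lambda>_. c) \<in> trig_fun"
| cos: "cos \<in> trig_fun"
| sin: "sin \<in> trig_fun"
| add: "f \<in> trig_fun \<Longrightarrow> g \<in> trig_fun \<Longrightarrow> (\<lambda>t. f t + g t) \<in> trig_fun"
| mult: "f \<in> trig_fun \<Longrightarrow> g \<in> trig_fun \<Longrightarrow> (\<lambda>t. f t * g t) \<in> trig_fun"

lemma trig_fun_uminus: "f \<in> trig_fun \<Longrightarrow> (\<lambda>t. - f t) \<in> trig_fun"
  using trig_fun.mult[OF trig_fun.const[of "-1"], of f] by simp

lemma trig_fun_diff: "f \<in> trig_fun \<Longrightarrow> g \<in> trig_fun \<Longrightarrow> (\<lambda>t. f t - g t) \<in> trig_fun"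
  using trig_fun.add[OF _ trig_fun_uminus, of f g] by simp

typedef trig_poly = trig_fun
  morphisms tp_eval Abs_trig_poly
  using trig_fun.cos by blast

setup_lifting type_definition_trig_poly

instantiation trig_poly :: "{comm_ring_1, real_algebra_1}"
begin

lift_definition zero_trig_poly :: trig_poly is "\<lambda>_. 0" by (rule trig_fun.const)
lift_definition one_trig_poly :: trig_poly is "\<lambda>_. 1" by (rule trig_fun.const)
lift_definition plus_trig_poly :: "trig_poly \<Rightarrow> trig_poly \<Rightarrow> trig_poly"
  is "\<lambda>f g t. f t + g t" by (rule trig_fun.add)
lift_definition times_trig_poly :: "trig_poly \<Rightarrow> trig_poly \<Rightarrow> trig_poly"
  is "\<lambda>f g t. f t * g t" by (rule trig_fun.mult)
lift_definition minus_trig_poly :: "trig_poly \<Rightarrow> trig_poly \<Rightarrow> trig_poly"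
  is "\<lambda>f g t. f t - g t" by (rule trig_fun_diff)
lift_definition uminus_trig_poly :: "trig_poly \<Rightarrow> trig_poly"
  is "\<lambda>f t. - f t" by (rule trig_fun_uminus)
lift_definition scaleR_trig_poly :: "real \<Rightarrow> trig_poly \<Rightarrow> trig_poly"
  is "\<lambda>k f t. k * f t" by (rule trig_fun.mult[OF trig_fun.const])

instance
  by standard (transfer; simp add: fun_eq_iff algebra_simps)+

end

lemma tp_eval_simps [simp]:
  "tp_eval 0 t = 0" "tp_eval 1 t = 1"
  "tp_eval (f + g) t = tp_eval f t + tp_eval g t"
  "tp_eval (f - g) t = tp_eval f t - tp_eval g t"
  "tp_eval (f * g) t = tp_eval f t * tp_eval g t"
  "tp_eval (- f) t = - tp_eval f t"
  "tp_eval (k *\<^sub>R f) t = k * tp_eval f t"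
  by (transfer; simp)+

lemma trig_poly_eqI: "(\<And>t. tp_eval f t = tp_eval g t) \<Longrightarrow> f = g"
  by transfer (simp add: fun_eq_iff)

lemma tp_eval_differentiable: "tp_eval f field_differentiable at t"
proof -
  have "g field_differentiable at t" if "g \<in> trig_fun" for g
    using that
    by (induction rule: trig_fun.induct)
      (auto intro: field_differentiable_add field_differentiable_mult
        field_differentiable_within_sin field_differentiable_within_cos)
  then show ?thesis
    using tp_eval by blast
qed

definition line_fun :: "trig_poly \<Rightarrow> trig_poly \<Rightarrow> real \<Rightarrow> real \<Rightarrow> real" where
  "line_fun P Q t x = tp_eval Q t - tp_eval P t * x"

definition curve :: "trig_poly \<Rightarrow> trig_poly \<Rightarrow> (real \<times> real) set" where
  "curve P Q = {(t, x). line_fun P Q t x = 0}"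

definition abel_field ::
  "trig_poly \<Rightarrow> trig_poly \<Rightarrow> (real \<Rightarrow> real \<Rightarrow> real) \<Rightarrow> real \<Rightarrow> real \<Rightarrow> real" where
  "abel_field A B f t x =
     deriv (\<lambda>s. f s x) t
     + (tp_eval A t * x ^ 3 + tp_eval B t * x ^ 2) * deriv (\<lambda>y. f t y) x"

definition invariant_curve ::
  "trig_poly \<Rightarrow> trig_poly \<Rightarrow> trig_poly \<Rightarrow> trig_poly \<Rightarrow> bool" where
  "invariant_curve A B P Q \<longleftrightarrow>
     (\<forall>t. tp_eval P t \<noteq> 0) \<and>
     irreducible [:Q, - P:] \<and>
     (\<exists>K :: real \<times> real \<Rightarrow> real. continuous_on UNIV K \<and>
        (\<forall>t x. abel_field A B (line_fun P Q) t x = K (t, x) * line_fun P Q t x))"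

definition two_different_nontrivial_curves ::
  "trig_poly \<Rightarrow> trig_poly \<Rightarrow> trig_poly \<Rightarrow> trig_poly \<Rightarrow> trig_poly \<Rightarrow> trig_poly \<Rightarrow> bool" where
  "two_different_nontrivial_curves A B P1 Q1 P2 Q2 \<longleftrightarrow>
     invariant_curve A B P1 Q1 \<and> Q1 \<noteq> 0 \<and>
     invariant_curve A B P2 Q2 \<and> Q2 \<noteq> 0 \<and>
     curve P1 Q1 \<noteq> curve P2 Q2"

text \<open>
  The quotient by \<open>Gh t\<close> below is never a division by zero: \<open>Gh\<close> is a non-zero product of
  irreducible elements (up to a constant), each of which divides the nowhere vanishing \<open>G\<close>.
\<close>

definition curve_data ::
  "trig_poly \<Rightarrow> trig_poly \<Rightarrow> trig_poly \<Rightarrow> trig_poly \<Rightarrow> trig_poly \<Rightarrow> real \<Rightarrow> bool" where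
  "curve_data A B G Gh S1 k \<longleftrightarrow>
     Gh \<noteq> 0 \<and> k \<noteq> 0 \<and>
     (\<forall>t. tp_eval G t \<noteq> 0) \<and>
     (\<forall>t. tp_eval S1 t \<noteq> 0) \<and>
     (\<forall>t. tp_eval S1 t + k * tp_eval Gh t \<noteq> 0) \<and>
     (\<forall>q. irreducible q \<and> q dvd Gh \<longrightarrow> q dvd G) \<and>
     (\<forall>t. tp_eval A t =
        tp_eval G t * tp_eval S1 t * (tp_eval S1 t + k * tp_eval Gh t)
        * (deriv (tp_eval G) t + tp_eval G t * deriv (tp_eval Gh) t / tp_eval Gh t)) \<and>
     (\<forall>t. tp_eval B t =
        - deriv (\<lambda>s. tp_eval G s * tp_eval S1 s) t
        - (tp_eval S1 t + k * tp_eval Gh t)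
        * (deriv (tp_eval G) t + tp_eval G t * deriv (tp_eval Gh) t / tp_eval Gh t))"

end

theory Submission
  imports Defs
begin

text \<open>
  A trigonometric polynomial is the restriction to the unit circle of a Laurent polynomial. Its
  zeros in the punctured plane that lie on the circle are its real zeros, and the others come in
  pairs \<open>w\<close>, \<open>1 / cnj w\<close>. The ring is not factorial, but a zero \<open>w\<close> off the circle always splits off
  the factor \<open>(dist (cis t) w)\<^sup>2\<close>, and an element without zeros is constant. Hence nowhere vanishing
  elements have greatest common divisors.

  If \<open>Q - P x\<close> is invariant then \<open>Q\<close> divides \<open>P\<^sup>2 Q'\<close>; as \<open>Q'/Q\<close> has a pole at each zero of \<open>Q\<close>,
  such a zero would be a zero of \<open>P\<close> too, contradicting irreducibility. So \<open>Q\<close> is a constant and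
  may be taken to be 1, and invariance becomes \<open>A + B P + P P' = 0\<close>. For two curves write
  \<open>P\<^sub>i = G S\<^sub>i\<close> with \<open>S\<^sub>1\<close>, \<open>S\<^sub>2\<close> without common zeros and put \<open>Gh = S\<^sub>2 - S\<^sub>1\<close>: subtracting the two
  equations shows that \<open>Gh\<close> divides \<open>S\<^sub>2 G Gh'\<close>, so by the same pole argument every zero of \<open>Gh\<close> is
  a zero of \<open>G\<close>.
\<close>

section \<open>Laurent polynomials on the unit circle\<close>

definition laurent_rep :: "(real \<Rightarrow> real) \<Rightarrow> complex poly \<Rightarrow> nat \<Rightarrow> bool" where
  "laurent_rep f p n \<longleftrightarrow> (\<forall>t. of_real (f t) * cis t ^ n = poly p (cis t))"

lemma laurent_rep_const: "laurent_rep (\<lambda>_. c) [:of_real c:] 0"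
  by (simp add: laurent_rep_def)

lemma laurent_rep_cos: "laurent_rep cos [:1/2, 0, 1/2:] 1"
  using sin_cos_squared_add3
  by (auto simp: laurent_rep_def complex_eq_iff field_simps)

lemma laurent_rep_sin: "laurent_rep sin [:\<i>/2, 0, -\<i>/2:] 1"
  using sin_cos_squared_add3
  by (auto simp: laurent_rep_def complex_eq_iff field_simps)

lemma laurent_rep_add:
  assumes "laurent_rep f p n" "laurent_rep g q m"
  shows "laurent_rep (\<lambda>t. f t + g t) (p * monom 1 m + q * monom 1 n) (n + m)"
  using assms unfolding laurent_rep_def
  by (simp add: poly_monom algebra_simps power_add)

lemma laurent_rep_mult:
  assumes "laurent_rep f p n" "laurent_rep g q m"
  shows "laurent_rep (\<lambda>t. f t * g t) (p * q) (n + m)"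
  using assms unfolding laurent_rep_def
  by (simp add: power_add) (metis mult.assoc mult.left_commute)

lemma laurent_rep_deriv:
  assumes f: "laurent_rep f p n" and f': "\<And>t. (f has_real_derivative f' t) (at t)"
  shows "laurent_rep f' (smult \<i> (pCons 0 (pderiv p) - smult (of_nat n) p)) n"
  unfolding laurent_rep_def
proof
  fix t
  have cis: "((\<lambda>t. cis (a * t)) has_vector_derivative of_real a * \<i> * cis (a * t)) (at t)" for a
    unfolding has_vector_derivative_def
    by (rule derivative_eq_intros | simp add: scaleR_conv_of_real mult_ac)+
  have "((\<lambda>t. of_real (f t)) has_vector_derivative (of_real (f' t) :: complex)) (at t)"
    using f'[of t]
    by (intro has_vector_derivative_of_real)
      (simp add: has_real_derivative_iff_has_vector_derivative)
  from has_vector_derivative_mult[OF this cis[of "real n"]]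
  have "((\<lambda>t. of_real (f t) * cis t ^ n) has_vector_derivative
      \<i> * of_nat n * (of_real (f t) * cis t ^ n) + of_real (f' t) * cis t ^ n) (at t)"
    by (simp add: Complex.DeMoivre mult_ac)
  moreover have "((\<lambda>t. poly p (cis t)) has_vector_derivative
      \<i> * (cis t * poly (pderiv p) (cis t))) (at t)"
    using field_vector_diff_chain_at[OF cis[of 1] poly_DERIV] by (simp add: o_def mult_ac)
  ultimately have "\<i> * of_nat n * poly p (cis t) + of_real (f' t) * cis t ^ n
      = \<i> * (cis t * poly (pderiv p) (cis t))"
    using f vector_derivative_unique_at by (force simp: laurent_rep_def)
  then show "of_real (f' t) * cis t ^ n
      = poly (smult \<i> (pCons 0 (pderiv p) - smult (of_nat n) p)) (cis t)"
    by (simp add: algebra_simps)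
qed

lemma laurent_rep_cnj:
  assumes "laurent_rep f p n"
  shows "laurent_rep f (monom 1 n * reflect_poly (map_poly cnj p)) (degree p)"
  unfolding laurent_rep_def
proof
  fix t
  have cis: "cis t * cnj (cis t) = 1"
    by (simp add: cis_cnj cis_mult)
  have "of_real (f t) = of_real (f t) * (cis t * cnj (cis t)) ^ n"
    by (simp add: cis)
  also have "\<dots> = cis t ^ n * cnj (of_real (f t) * cis t ^ n)"
    by (simp add: power_mult_distrib)
  also have "of_real (f t) * cis t ^ n = poly p (cis t)"
    using assms by (simp add: laurent_rep_def)
  finally show "of_real (f t) * cis t ^ degree p
      = poly (monom 1 n * reflect_poly (map_poly cnj p)) (cis t)"
    by (simp add: poly_monom poly_reflect_poly_nz degree_map_poly cis_cnj)
qed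

lemma infinite_range_cis: "infinite (range cis)"
proof
  assume fin: "finite (range cis)"
  have "connected (range cis)"
    by (intro connected_continuous_image continuous_intros) simp
  then obtain a where "range cis = {a}"
    using fin by (auto simp: connected_finite_iff_sing)
  then have "cis 0 = a" "cis pi = a"
    by blast+
  then show False
    by (simp add: complex_eq_iff)
qed

lemma poly_eqI_unit_circle:
  fixes p q :: "complex poly"
  assumes "\<And>t. poly p (cis t) = poly q (cis t)"
  shows "p = q"
proof (rule ccontr)
  assume "p \<noteq> q"
  then have "finite {z. poly (p - q) z = 0}"
    by (intro poly_roots_finite) simp
  moreover have "range cis \<subseteq> {z. poly (p - q) z = 0}"
    using assms by auto
  ultimately show False
    using infinite_range_cis finite_subset by blast
qed

lemma laurent_rep_unique:
  assumes "laurent_rep f p n" "laurent_rep f q m"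
  shows "p * monom 1 m = q * monom 1 n"
proof (rule poly_eqI_unit_circle)
  fix t
  have "poly p (cis t) * cis t ^ m = of_real (f t) * cis t ^ n * cis t ^ m"
    using assms(1) by (simp add: laurent_rep_def)
  also have "\<dots> = poly q (cis t) * cis t ^ n"
    using assms(2) by (simp add: laurent_rep_def mult_ac)
  finally show "poly (p * monom 1 m) (cis t) = poly (q * monom 1 n) (cis t)"
    by (simp add: poly_monom)
qed

lemma laurent_rep_eq_0_iff:
  assumes "laurent_rep f p n"
  shows "p = 0 \<longleftrightarrow> f = (\<lambda>_. 0)"
proof
  assume "p = 0"
  with assms show "f = (\<lambda>_. 0)"
    by (simp add: laurent_rep_def fun_eq_iff)
next
  assume "f = (\<lambda>_. 0)"
  with assms show "p = 0"
    by (intro poly_eqI_unit_circle) (auto simp: laurent_rep_def)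
qed

definition complex_trig_fun :: "(real \<Rightarrow> complex) set" where
  "complex_trig_fun = {F. (\<lambda>t. Re (F t)) \<in> trig_fun \<and> (\<lambda>t. Im (F t)) \<in> trig_fun}"

lemma complex_trig_fun_const: "(\<lambda>_. c) \<in> complex_trig_fun"
  by (simp add: complex_trig_fun_def trig_fun.const)

lemma complex_trig_fun_cis: "cis \<in> complex_trig_fun"
  by (simp add: complex_trig_fun_def trig_fun.cos trig_fun.sin)

lemma complex_trig_fun_cnj: "F \<in> complex_trig_fun \<Longrightarrow> (\<lambda>t. cnj (F t)) \<in> complex_trig_fun"
  by (simp add: complex_trig_fun_def trig_fun_uminus)

lemma complex_trig_fun_add:
  "F \<in> complex_trig_fun \<Longrightarrow> G \<in> complex_trig_fun \<Longrightarrow> (\<lambda>t. F t + G t) \<in> complex_trig_fun"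
  by (simp add: complex_trig_fun_def trig_fun.add)

lemma complex_trig_fun_mult:
  "F \<in> complex_trig_fun \<Longrightarrow> G \<in> complex_trig_fun \<Longrightarrow> (\<lambda>t. F t * G t) \<in> complex_trig_fun"
  by (simp add: complex_trig_fun_def trig_fun.add trig_fun_diff trig_fun.mult)

lemma complex_trig_fun_power:
  assumes "F \<in> complex_trig_fun"
  shows "(\<lambda>t. F t ^ n) \<in> complex_trig_fun"
  by (induction n) (simp_all add: complex_trig_fun_const complex_trig_fun_mult assms)

lemma complex_trig_fun_poly:
  assumes "F \<in> complex_trig_fun"
  shows "(\<lambda>t. poly p (F t)) \<in> complex_trig_fun"
  by (induction p)
    (simp_all add: complex_trig_fun_const complex_trig_fun_add complex_trig_fun_mult assms)

lemma trig_fun_iff_laurent_rep: "f \<in> trig_fun \<longleftrightarrow> (\<exists>p n. laurent_rep f p n)"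
proof
  assume "f \<in> trig_fun"
  then show "\<exists>p n. laurent_rep f p n"
    by (induction rule: trig_fun.induct)
      (blast intro: laurent_rep_const laurent_rep_cos laurent_rep_sin
        laurent_rep_add laurent_rep_mult)+
next
  assume "\<exists>p n. laurent_rep f p n"
  then obtain p n where f: "laurent_rep f p n"
    by blast
  have "f = (\<lambda>t. Re (cnj (cis t) ^ n * poly p (cis t)))"
  proof
    fix t
    have "cnj (cis t) ^ n * poly p (cis t) = (cnj (cis t) * cis t) ^ n * of_real (f t)"
      using f by (simp add: laurent_rep_def power_mult_distrib mult_ac)
    also have "cnj (cis t) * cis t = 1"
      by (simp add: cis_cnj cis_mult)
    finally show "f t = Re (cnj (cis t) ^ n * poly p (cis t))"
      by simp
  qed
  moreover have "(\<lambda>t. cnj (cis t) ^ n * poly p (cis t)) \<in> complex_trig_fun"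
    by (intro complex_trig_fun_mult complex_trig_fun_power complex_trig_fun_poly
        complex_trig_fun_cnj complex_trig_fun_cis)
  ultimately show "f \<in> trig_fun"
    unfolding complex_trig_fun_def by blast
qed

section \<open>Complex zeros of trigonometric polynomials\<close>

lemma
  shows tp_eval_zero_fun: "tp_eval 0 = (\<lambda>_. 0)"
    and tp_eval_one_fun: "tp_eval 1 = (\<lambda>_. 1)"
    and tp_eval_add_fun: "tp_eval (f + g) = (\<lambda>t. tp_eval f t + tp_eval g t)"
    and tp_eval_mult_fun: "tp_eval (f * g) = (\<lambda>t. tp_eval f t * tp_eval g t)"
    and tp_eval_scaleR_fun: "tp_eval (c *\<^sub>R f) = (\<lambda>t. c * tp_eval f t)"
  by (simp_all add: fun_eq_iff)

lemma tp_eval_eq_0_fun_iff: "tp_eval f = (\<lambda>_. 0) \<longleftrightarrow> f = 0"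
  using tp_eval_inject[of f 0] by (simp add: tp_eval_zero_fun)

lemma laurent_rep_tp_eval:
  obtains p n where "laurent_rep (tp_eval f) p n"
  using tp_eval[of f] unfolding trig_fun_iff_laurent_rep by blast

instance trig_poly :: idom
proof
  fix f g :: trig_poly
  assume nz: "f \<noteq> 0" "g \<noteq> 0"
  obtain p n q m where rep: "laurent_rep (tp_eval f) p n" "laurent_rep (tp_eval g) q m"
    by (meson laurent_rep_tp_eval)
  then have "p * q \<noteq> 0"
    using nz by (simp add: laurent_rep_eq_0_iff tp_eval_eq_0_fun_iff)
  then have "tp_eval (f * g) \<noteq> (\<lambda>_. 0)"
    using laurent_rep_eq_0_iff[OF laurent_rep_mult[OF rep]] by (simp add: tp_eval_mult_fun)
  then show "f * g \<noteq> 0"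
    by (simp only: tp_eval_eq_0_fun_iff not_False_eq_True)
qed

lemma trig_poly_eqI_off_zeros:
  assumes "h \<noteq> 0" and "\<And>t. tp_eval h t \<noteq> 0 \<Longrightarrow> tp_eval f t = tp_eval g t"
  shows "f = g"
proof -
  have "h * f = h * g"
    by (rule trig_poly_eqI) (use assms(2) in auto)
  then show ?thesis
    using assms(1) by simp
qed

text \<open>The zeros in the punctured plane of the Laurent polynomial that extends \<open>f\<close> from the circle.\<close>

definition tp_zeros :: "trig_poly \<Rightarrow> complex set" where
  "tp_zeros f = {w. w \<noteq> 0 \<and> (\<exists>p n. laurent_rep (tp_eval f) p n \<and> poly p w = 0)}"

lemma tp_zeros_eq:
  assumes "laurent_rep (tp_eval f) p n"
  shows "tp_zeros f = {w. w \<noteq> 0 \<and> poly p w = 0}"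
proof -
  have "poly p w = 0" if "laurent_rep (tp_eval f) q m" "poly q w = 0" "w \<noteq> 0" for w q m
  proof -
    have "poly (p * monom 1 m) w = poly (q * monom 1 n) w"
      using laurent_rep_unique[OF assms that(1)] by simp
    then show ?thesis
      using that by (simp add: poly_monom)
  qed
  then show ?thesis
    using assms by (auto simp: tp_zeros_def)
qed

lemma tp_zeros_nonzero: "w \<in> tp_zeros f \<Longrightarrow> w \<noteq> 0"
  by (simp add: tp_zeros_def)

lemma tp_zeros_mult: "tp_zeros (f * g) = tp_zeros f \<union> tp_zeros g"
proof -
  obtain p n q m where rep: "laurent_rep (tp_eval f) p n" "laurent_rep (tp_eval g) q m"
    by (meson laurent_rep_tp_eval)
  then have "laurent_rep (tp_eval (f * g)) (p * q) (n + m)"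
    unfolding tp_eval_mult_fun by (rule laurent_rep_mult)
  then show ?thesis
    by (auto simp: rep[THEN tp_zeros_eq] tp_zeros_eq)
qed

lemma tp_zeros_dvd: "f dvd g \<Longrightarrow> tp_zeros f \<subseteq> tp_zeros g"
  by (auto simp: tp_zeros_mult)

lemma tp_zeros_diff: "tp_zeros f \<inter> tp_zeros g \<subseteq> tp_zeros (f - g)"
proof -
  obtain p n q m where rep: "laurent_rep (tp_eval f) p n" "laurent_rep (tp_eval g) q m"
    by (meson laurent_rep_tp_eval)
  then have "laurent_rep (tp_eval (f - g)) (p * monom 1 m - q * monom 1 n) (n + m)"
    by (simp add: laurent_rep_def poly_monom algebra_simps power_add)
  then show ?thesis
    by (auto simp: rep[THEN tp_zeros_eq] tp_zeros_eq)
qed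

lemma tp_zeros_const: "c \<noteq> 0 \<Longrightarrow> tp_zeros (c *\<^sub>R 1) = {}"
  using tp_zeros_eq[of "c *\<^sub>R 1"] laurent_rep_const[of c]
  by (simp add: tp_eval_scaleR_fun tp_eval_one_fun)

lemma cis_in_tp_zeros_iff: "cis t \<in> tp_zeros f \<longleftrightarrow> tp_eval f t = 0"
proof -
  obtain p n where rep: "laurent_rep (tp_eval f) p n"
    by (rule laurent_rep_tp_eval)
  then have "poly p (cis t) = of_real (tp_eval f t) * cis t ^ n"
    by (simp add: laurent_rep_def)
  then show ?thesis
    by (simp add: tp_zeros_eq[OF rep])
qed

lemma tp_zeros_inverse_cnj:
  assumes "w \<in> tp_zeros f"
  shows "inverse (cnj w) \<in> tp_zeros f"
proof -
  obtain p n where rep: "laurent_rep (tp_eval f) p n"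
    by (rule laurent_rep_tp_eval)
  have "w \<noteq> 0" "poly p w = 0"
    using assms by (simp_all add: tp_zeros_eq[OF rep])
  then show ?thesis
    by (simp add: tp_zeros_eq[OF laurent_rep_cnj[OF rep]] poly_reflect_poly_nz)
qed

lemma complex_poly_eq_monom:
  fixes p :: "complex poly"
  assumes "\<And>w. poly p w = 0 \<Longrightarrow> w = 0"
  shows "p = monom (lead_coeff p) (order 0 p)"
proof (cases "poly p 0 = 0")
  case True
  then have "{w. poly p w = 0} = {0}"
    using assms by blast
  then show ?thesis
    using complex_poly_decompose[of p] by (simp add: monom_altdef)
next
  case False
  then have "{w. poly p w = 0} = {}"
    using assms by blast
  then show ?thesis
    using complex_poly_decompose[of p] False by (simp add: order_0I monom_0)
qed

lemma tp_zeros_emptyE: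
  assumes "tp_zeros f = {}"
  obtains c where "c \<noteq> 0" "f = c *\<^sub>R 1"
proof -
  obtain p n where rep: "laurent_rep (tp_eval f) p n"
    by (rule laurent_rep_tp_eval)
  define a where "a = norm (lead_coeff p)"
  have p: "p = monom (lead_coeff p) (order 0 p)"
    using assms unfolding tp_zeros_eq[OF rep] by (intro complex_poly_eq_monom) blast
  have abs_eval: "\<bar>tp_eval f t\<bar> = a" for t
  proof -
    have "norm (of_real (tp_eval f t) * cis t ^ n) = norm (poly p (cis t))"
      using rep by (simp add: laurent_rep_def)
    also have "\<dots> = a"
      by (subst p) (simp add: poly_monom norm_mult norm_power a_def)
    finally show ?thesis
      by (simp add: norm_mult norm_power)
  qed
  then have "(tp_eval f t)\<^sup>2 = a\<^sup>2" for t
    by (metis power2_abs)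
  then have "(f - a *\<^sub>R 1) * (f + a *\<^sub>R 1) = 0"
    by (intro trig_poly_eqI) (simp add: algebra_simps power2_eq_square)
  then have "f = a *\<^sub>R 1 \<or> f = (- a) *\<^sub>R 1"
    by (auto simp: eq_neg_iff_add_eq_0)
  moreover have "a \<noteq> 0"
    using assms cis_in_tp_zeros_iff[of 0 f] abs_eval[of 0] by auto
  ultimately show ?thesis
    using that by (metis neg_equal_0_iff_equal)
qed

lemma tp_is_unit_iff: "f dvd 1 \<longleftrightarrow> tp_zeros f = {}" for f :: trig_poly
proof
  assume "f dvd 1"
  then obtain g where "1 = f * g"
    by (rule dvdE)
  then show "tp_zeros f = {}"
    using tp_zeros_const[of 1] tp_zeros_mult[of f g] by simp
next
  assume "tp_zeros f = {}"
  then obtain c where "c \<noteq> 0" "f = c *\<^sub>R 1"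
    by (rule tp_zeros_emptyE)
  then have "1 = f * ((1 / c) *\<^sub>R 1)"
    by simp
  then show "f dvd 1"
    by (rule dvdI)
qed

definition nowhere_zero :: "trig_poly \<Rightarrow> bool" where
  "nowhere_zero f \<longleftrightarrow> (\<forall>t. tp_eval f t \<noteq> 0)"

lemma nowhere_zero_iff: "nowhere_zero f \<longleftrightarrow> (\<forall>w\<in>tp_zeros f. norm w \<noteq> 1)"
proof -
  have "w \<in> range cis" if "norm w = 1" for w
    using that cis_Arg[of w] by (metis div_by_1 norm_zero of_real_1 rangeI sgn_eq zero_neq_one)
  then show ?thesis
    by (auto simp: nowhere_zero_def simp flip: cis_in_tp_zeros_iff)
qed

lemma nowhere_zero_mult: "nowhere_zero (f * g) \<longleftrightarrow> nowhere_zero f \<and> nowhere_zero g"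
  by (auto simp: nowhere_zero_def)

lemma nowhere_zero_imp_nonzero: "nowhere_zero f \<Longrightarrow> f \<noteq> 0"
  by (auto simp: nowhere_zero_def)

section \<open>Divisibility and zeros off the unit circle\<close>

lemma laurent_rep_circle_dist_sq:
  "laurent_rep (\<lambda>t. (dist (cis t) w)\<^sup>2) ([:- w, 1:] * [:1, - cnj w:]) 1"
  unfolding laurent_rep_def
proof
  fix t
  have "of_real ((dist (cis t) w)\<^sup>2) * cis t ^ 1
      = (cis t - w) * (cnj (cis t) * cis t - cnj w * cis t)"
    by (simp add: dist_norm complex_norm_square algebra_simps del: of_real_power)
  also have "cnj (cis t) * cis t = 1"
    by (simp add: cis_cnj cis_mult)
  finally show "of_real ((dist (cis t) w)\<^sup>2) * cis t ^ 1
      = poly ([:- w, 1:] * [:1, - cnj w:]) (cis t)"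
    by (simp add: algebra_simps)
qed

lift_definition circle_dist_sq :: "complex \<Rightarrow> trig_poly" is "\<lambda>w t. (dist (cis t) w)\<^sup>2"
  using laurent_rep_circle_dist_sq trig_fun_iff_laurent_rep by blast

lemma in_tp_zeros_circle_dist_sq: "w \<noteq> 0 \<Longrightarrow> w \<in> tp_zeros (circle_dist_sq w)"
  using tp_zeros_eq[of "circle_dist_sq w"] laurent_rep_circle_dist_sq[of w]
  by (simp add: circle_dist_sq.rep_eq)

lemma conjugate_zeros_dvd:
  assumes "poly p w = 0" "poly p (inverse (cnj w)) = 0" "w \<noteq> 0" "norm w \<noteq> 1"
  shows "[:- w, 1:] * [:1, - cnj w:] dvd p"
proof -
  define v where "v = inverse (cnj w)"
  have "v \<noteq> w"
  proof
    assume "v = w"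
    then have "of_real ((norm w)\<^sup>2) = (1 :: complex)"
      using assms(3) by (simp add: v_def complex_norm_square field_simps del: of_real_power)
    then show False
      using assms(4) power2_eq_iff_nonneg[of "norm w" 1] by (simp del: of_real_power)
  qed
  obtain q where q: "p = [:- w, 1:] * q"
    using assms(1) by (auto simp: poly_eq_0_iff_dvd)
  have "poly q v = 0"
    using assms(2) \<open>v \<noteq> w\<close> by (simp add: q v_def)
  then obtain r where r: "q = [:- v, 1:] * r"
    by (auto simp: poly_eq_0_iff_dvd)
  have "[:- v, 1:] = smult (- v) [:1, - cnj w:]"
    using assms(3) by (simp add: v_def)
  then have "p = [:- w, 1:] * [:1, - cnj w:] * smult (- v) r"
    by (simp only: q r) (simp only: mult_smult_left mult_smult_right mult.assoc)
  then show ?thesis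
    by (rule dvdI)
qed

lemma laurent_rep_divide_circle_dist_sq:
  assumes rep: "laurent_rep f ([:- w, 1:] * [:1, - cnj w:] * r) n" and "norm w \<noteq> 1"
  shows "laurent_rep (\<lambda>t. f t / (dist (cis t) w)\<^sup>2) (pCons 0 r) n"
  unfolding laurent_rep_def
proof
  fix t
  have "of_real (f t) * cis t ^ n = poly ([:- w, 1:] * [:1, - cnj w:]) (cis t) * poly r (cis t)"
    using rep by (simp only: laurent_rep_def poly_mult)
  also have "poly ([:- w, 1:] * [:1, - cnj w:]) (cis t) = of_real ((dist (cis t) w)\<^sup>2) * cis t"
    using laurent_rep_circle_dist_sq[of w] by (simp only: laurent_rep_def power_one_right)
  finally have "of_real (f t) * cis t ^ n
      = of_real ((dist (cis t) w)\<^sup>2) * poly (pCons 0 r) (cis t)"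
    by (simp del: of_real_power)
  moreover have "cis t \<noteq> w"
    using \<open>norm w \<noteq> 1\<close> by auto
  ultimately show "of_real (f t / (dist (cis t) w)\<^sup>2) * cis t ^ n = poly (pCons 0 r) (cis t)"
    by (simp add: field_simps del: of_real_power)
qed

lemma circle_dist_sq_factorE:
  assumes rep: "laurent_rep (tp_eval f) p n" and "f \<noteq> 0"
    and w: "w \<in> tp_zeros f" "norm w \<noteq> 1"
  obtains g q where "f = circle_dist_sq w * g" "laurent_rep (tp_eval g) q n" "degree q < degree p"
proof -
  have "[:- w, 1:] * [:1, - cnj w:] dvd p"
    by (rule conjugate_zeros_dvd)
      (use w tp_zeros_inverse_cnj[OF w(1)] in \<open>simp_all add: tp_zeros_eq[OF rep]\<close>)
  then obtain r where r: "p = [:- w, 1:] * [:1, - cnj w:] * r"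
    by (rule dvdE)
  have quotient: "laurent_rep (\<lambda>t. tp_eval f t / (dist (cis t) w)\<^sup>2) (pCons 0 r) n"
    using rep w(2) unfolding r by (rule laurent_rep_divide_circle_dist_sq)
  then obtain g where g: "tp_eval g = (\<lambda>t. tp_eval f t / (dist (cis t) w)\<^sup>2)"
    using trig_fun_iff_laurent_rep tp_eval_cases by metis
  have "cis t \<noteq> w" for t
    using w(2) by auto
  then have "f = circle_dist_sq w * g"
    by (intro trig_poly_eqI) (simp add: g circle_dist_sq.rep_eq)
  moreover have "degree (pCons 0 r) < degree p"
  proof -
    have "p \<noteq> 0"
      using \<open>f \<noteq> 0\<close> laurent_rep_eq_0_iff[OF rep] by (simp add: tp_eval_eq_0_fun_iff)
    then have "w \<noteq> 0" "r \<noteq> 0"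
      using tp_zeros_nonzero[OF w(1)] r by auto
    then have "degree p = degree ([:- w, 1:] * [:1, - cnj w:]) + degree r"
      unfolding r by (intro degree_mult_eq) auto
    then show ?thesis
      using \<open>w \<noteq> 0\<close> by (simp add: degree_pCons_eq_if)
  qed
  ultimately show ?thesis
    using that quotient g by metis
qed

lemma circle_dist_sq_dvd_iff:
  assumes "w \<noteq> 0" "norm w \<noteq> 1"
  shows "circle_dist_sq w dvd f \<longleftrightarrow> w \<in> tp_zeros f"
proof
  assume "circle_dist_sq w dvd f"
  then show "w \<in> tp_zeros f"
    using in_tp_zeros_circle_dist_sq[OF assms(1)] tp_zeros_dvd by blast
next
  assume "w \<in> tp_zeros f"
  then show "circle_dist_sq w dvd f"
    using assms(2) circle_dist_sq_factorE laurent_rep_tp_eval by (metis dvd_0_right dvdI)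
qed

lemma coprime_zeros_factorization:
  assumes "nowhere_zero f"
  obtains d f' g' where "f = d * f'" "g = d * g'" "tp_zeros f' \<inter> tp_zeros g' = {}"
proof -
  obtain p n where "laurent_rep (tp_eval f) p n"
    by (rule laurent_rep_tp_eval)
  with assms have "\<exists>d f' g'. f = d * f' \<and> g = d * g' \<and> tp_zeros f' \<inter> tp_zeros g' = {}"
  proof (induction "degree p" arbitrary: f g p rule: less_induct)
    case less
    show ?case
    proof (cases "tp_zeros f \<inter> tp_zeros g = {}")
      case True
      then show ?thesis
        by (metis mult_1)
    next
      case False
      then obtain w where w: "w \<in> tp_zeros f" "w \<in> tp_zeros g"
        by blast
      have "norm w \<noteq> 1"
        using w(1) less.prems(1) by (auto simp: nowhere_zero_iff)
      then obtain f\<^sub>0 q where f\<^sub>0: "f = circle_dist_sq w * f\<^sub>0"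
          "laurent_rep (tp_eval f\<^sub>0) q n" "degree q < degree p"
        using circle_dist_sq_factorE less.prems w(1) nowhere_zero_imp_nonzero by metis
      obtain g\<^sub>0 where g\<^sub>0: "g = circle_dist_sq w * g\<^sub>0"
        using \<open>norm w \<noteq> 1\<close> w(2) tp_zeros_nonzero circle_dist_sq_dvd_iff by (metis dvdE)
      have "nowhere_zero f\<^sub>0"
        using less.prems(1) f\<^sub>0(1) by (simp add: nowhere_zero_mult)
      then obtain d f' g' where "f\<^sub>0 = d * f'" "g\<^sub>0 = d * g'" "tp_zeros f' \<inter> tp_zeros g' = {}"
        using less.hyps[OF f\<^sub>0(3) _ f\<^sub>0(2)] by blast
      then show ?thesis
        using f\<^sub>0(1) g\<^sub>0 by (metis mult.assoc)
    qed
  qed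
  then show ?thesis
    using that by blast
qed

lemma irreducible_dvd_if_tp_zeros_subset:
  assumes "irreducible q" "q dvd f" "tp_zeros f \<subseteq> tp_zeros g" "nowhere_zero g"
  shows "q dvd g"
proof -
  obtain w where "w \<in> tp_zeros q"
    using irreducible_not_unit[OF assms(1)] by (auto simp: tp_is_unit_iff)
  then have w: "w \<in> tp_zeros g" "w \<noteq> 0" "norm w \<noteq> 1"
    using assms(2-4) tp_zeros_dvd tp_zeros_nonzero nowhere_zero_iff by blast+
  obtain c where c: "q = circle_dist_sq w * c"
    using \<open>w \<in> tp_zeros q\<close> w circle_dist_sq_dvd_iff by (metis dvdE)
  moreover have "\<not> circle_dist_sq w dvd 1"
    using in_tp_zeros_circle_dist_sq[OF w(2)] by (auto simp: tp_is_unit_iff)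
  ultimately have "c dvd 1"
    using irreducibleD[OF assms(1)] by blast
  then have "q dvd circle_dist_sq w"
    using c by (simp add: mult_unit_dvd_iff)
  then show ?thesis
    using w circle_dist_sq_dvd_iff dvd_trans by blast
qed

section \<open>Derivatives\<close>

lemma deriv_trig_fun:
  assumes "f \<in> trig_fun"
  shows "deriv f \<in> trig_fun"
proof -
  have "(f has_real_derivative deriv f t) (at t)" for t
    using assms tp_eval_differentiable
    by (metis DERIV_deriv_iff_field_differentiable tp_eval_cases)
  then show ?thesis
    using assms laurent_rep_deriv trig_fun_iff_laurent_rep by metis
qed

lift_definition tp_deriv :: "trig_poly \<Rightarrow> trig_poly" is deriv
  by (rule deriv_trig_fun)

lemma deriv_tp_eval: "deriv (tp_eval f) = tp_eval (tp_deriv f)"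
  by transfer simp

lemma has_real_derivative_tp_eval:
  "(tp_eval f has_real_derivative tp_eval (tp_deriv f) t) (at t)"
  using tp_eval_differentiable[of f t]
  by (simp add: field_differentiable_derivI flip: deriv_tp_eval)

lemma tp_derivI:
  assumes "\<And>t. (tp_eval f has_real_derivative tp_eval g t) (at t)"
  shows "tp_deriv f = g"
  using assms by (intro trig_poly_eqI) (metis DERIV_unique has_real_derivative_tp_eval)

lemma tp_deriv_mult: "tp_deriv (f * g) = f * tp_deriv g + tp_deriv f * g"
  by (rule tp_derivI) (simp add: tp_eval_mult_fun DERIV_mult' has_real_derivative_tp_eval)

lemma tp_deriv_add: "tp_deriv (f + g) = tp_deriv f + tp_deriv g"
  by (rule tp_derivI) (simp add: tp_eval_add_fun DERIV_add has_real_derivative_tp_eval)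

lemma tp_deriv_scaleR: "tp_deriv (c *\<^sub>R f) = c *\<^sub>R tp_deriv f"
  by (rule tp_derivI) (simp add: tp_eval_scaleR_fun DERIV_cmult has_real_derivative_tp_eval)

lemma tp_deriv_one: "tp_deriv 1 = 0"
  by (rule tp_derivI) (simp add: tp_eval_zero_fun tp_eval_one_fun)

lemma root_if_dvd_mult_pderiv:
  fixes p v :: "'a :: {idom, semiring_char_0} poly"
  assumes "p dvd v * pderiv p" "p \<noteq> 0" "poly p w = 0"
  shows "poly v w = 0"
proof (rule ccontr)
  assume v: "poly v w \<noteq> 0"
  obtain u where u: "v * pderiv p = p * u"
    using assms(1) by (rule dvdE)
  have "pderiv p \<noteq> 0"
  proof
    assume "pderiv p = 0"
    then obtain c where "p = [:c:]"
      unfolding pderiv_eq_0_iff by (rule degree_eq_zeroE)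
    then show False
      using assms(2,3) by simp
  qed
  then have nz: "v * pderiv p \<noteq> 0"
    using v by auto
  have "order w p \<le> order w (v * pderiv p)"
    using nz u by (simp add: order_mult)
  also have "\<dots> = order w (pderiv p)"
    using nz v by (simp add: order_mult order_0I)
  finally show False
    using order_pderiv[OF assms(2,3)] by simp
qed

text \<open>The logarithmic derivative of \<open>f\<close> has a pole at every zero of \<open>f\<close>.\<close>

lemma tp_zeros_subset_if_dvd_mult_tp_deriv:
  assumes "f dvd g * tp_deriv f" "f \<noteq> 0"
  shows "tp_zeros f \<subseteq> tp_zeros g"
proof
  fix w
  assume w: "w \<in> tp_zeros f"
  obtain h where h: "g * tp_deriv f = f * h"
    using assms(1) by (rule dvdE)
  obtain p n where p: "laurent_rep (tp_eval f) p n"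
    by (rule laurent_rep_tp_eval)
  obtain v l where v: "laurent_rep (tp_eval g) v l"
    by (rule laurent_rep_tp_eval)
  obtain q m where q: "laurent_rep (tp_eval h) q m"
    by (rule laurent_rep_tp_eval)
  define d where "d = smult \<i> (pCons 0 (pderiv p) - smult (of_nat n) p)"
  have "v * d * monom 1 (n + m) = p * q * monom 1 (l + n)"
    using laurent_rep_mult[OF v laurent_rep_deriv[OF p has_real_derivative_tp_eval]]
      laurent_rep_mult[OF p q] h
    unfolding d_def tp_eval_mult_fun[symmetric] by (intro laurent_rep_unique) simp_all
  moreover have "d = monom \<i> 1 * pderiv p - smult (\<i> * of_nat n) p"
    by (simp add: d_def monom_altdef smult_diff_right)
  ultimately have "(v * monom \<i> 1 * monom 1 (n + m)) * pderiv p
      = p * (q * monom 1 (l + n) + smult (\<i> * of_nat n) (v * monom 1 (n + m)))"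
    by (simp add: algebra_simps)
  moreover have "p \<noteq> 0" "poly p w = 0"
    using assms(2) w laurent_rep_eq_0_iff[OF p]
    by (simp_all add: tp_eval_eq_0_fun_iff tp_zeros_eq[OF p])
  ultimately have "poly (v * monom \<i> 1 * monom 1 (n + m)) w = 0"
    by (metis dvd_triv_left root_if_dvd_mult_pderiv)
  then show "w \<in> tp_zeros g"
    using tp_zeros_nonzero[OF w] by (simp add: tp_zeros_eq[OF v] poly_monom)
qed

section \<open>Invariant curves as reciprocals of solutions\<close>

lemma irreducible_linear_polyD:
  fixes a b c :: "'a :: idom"
  assumes "irreducible [:a, b:]" "b \<noteq> 0" "c dvd a" "c dvd b"
  shows "c dvd 1"
proof -
  obtain a' b' where ab: "a = c * a'" "b = c * b'"
    using assms(3,4) by (auto elim!: dvdE)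
  then have "[:a, b:] = [:c:] * [:a', b':]"
    by simp
  moreover have "\<not> [:a', b':] dvd 1"
    using ab assms(2) by (auto simp: is_unit_poly_iff)
  ultimately show ?thesis
    using irreducibleD[OF assms(1)] is_unit_const_poly_iff by blast
qed

lemma irreducible_linear_polyI:
  fixes a b :: "'a :: idom"
  assumes "b \<noteq> 0" and coprime: "\<And>c. c dvd a \<Longrightarrow> c dvd b \<Longrightarrow> c dvd 1"
  shows "irreducible [:a, b:]"
proof (rule irreducibleI)
  have unit: "p dvd 1" if p: "degree p = 0" "p dvd [:a, b:]" for p
  proof -
    obtain c where c: "p = [:c:]"
      using p(1) by (rule degree_eq_zeroE)
    then have "c dvd coeff [:a, b:] 0" "c dvd coeff [:a, b:] 1"
      using p(2) const_poly_dvd_iff by blast+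
    then show ?thesis
      using coprime c by (simp add: is_unit_const_poly_iff)
  qed
  fix p q
  assume pq: "[:a, b:] = p * q"
  with assms have "p \<noteq> 0" "q \<noteq> 0"
    by auto
  then have "degree p + degree q = 1"
    using assms by (simp flip: degree_mult_eq pq)
  then have "degree p = 0 \<or> degree q = 0"
    by arith
  then show "p dvd 1 \<or> q dvd 1"
    using unit pq by (metis dvd_triv_left dvd_triv_right)
qed (use assms in \<open>auto simp: is_unit_poly_iff\<close>)

lemma abel_field_line_fun:
  "abel_field A B (line_fun P Q) t x = tp_eval (tp_deriv Q) t - tp_eval (tp_deriv P) t * x
    - (tp_eval A t * x ^ 3 + tp_eval B t * x ^ 2) * tp_eval P t"
proof -
  have "((\<lambda>s. line_fun P Q s x) has_real_derivative
      tp_eval (tp_deriv Q) t - tp_eval (tp_deriv P) t * x) (at t)"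
    unfolding line_fun_def
    by (intro DERIV_diff DERIV_cmult_right has_real_derivative_tp_eval)
  moreover have "((\<lambda>y. line_fun P Q t y) has_real_derivative - tp_eval P t) (at x)"
    unfolding line_fun_def by (auto intro!: derivative_eq_intros)
  ultimately show ?thesis
    unfolding abel_field_def by (simp add: DERIV_imp_deriv)
qed

lemma invariant_curve_imp_eq:
  assumes "invariant_curve A B P Q"
  shows "P * (P * tp_deriv Q - tp_deriv P * Q) = Q * Q * (A * Q + B * P)"
proof (rule trig_poly_eqI)
  fix t
  define x where "x = tp_eval Q t / tp_eval P t"
  have Q: "tp_eval Q t = tp_eval P t * x"
    using assms by (simp add: x_def invariant_curve_def)
  then have "line_fun P Q t x = 0"
    by (simp add: line_fun_def)
  then have "abel_field A B (line_fun P Q) t x = 0"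
    using assms by (auto simp: invariant_curve_def)
  then have "tp_eval (tp_deriv Q) t = tp_eval (tp_deriv P) t * x
      + (tp_eval A t * x ^ 3 + tp_eval B t * x ^ 2) * tp_eval P t"
    by (simp add: abel_field_line_fun)
  then show "tp_eval (P * (P * tp_deriv Q - tp_deriv P * Q)) t
      = tp_eval (Q * Q * (A * Q + B * P)) t"
    by (simp add: Q algebra_simps power2_eq_square power3_eq_cube)
qed

lemma invariant_curve_imp_const:
  assumes inv: "invariant_curve A B P Q" and "Q \<noteq> 0"
  obtains c where "c \<noteq> 0" "Q = c *\<^sub>R 1"
proof -
  have P: "nowhere_zero P"
    using inv by (simp add: invariant_curve_def nowhere_zero_def)
  have coprime: "d dvd 1" if "d dvd Q" "d dvd P" for d
    using inv nowhere_zero_imp_nonzero[OF P] irreducible_linear_polyD[of Q "- P" d] that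
    by (simp add: invariant_curve_def)
  have "(P * P) * tp_deriv Q = Q * (Q * (A * Q + B * P) + P * tp_deriv P)"
    using invariant_curve_imp_eq[OF inv] by (simp add: algebra_simps)
  then have "tp_zeros Q \<subseteq> tp_zeros (P * P)"
    using \<open>Q \<noteq> 0\<close> by (intro tp_zeros_subset_if_dvd_mult_tp_deriv) simp_all
  then have zeros: "tp_zeros Q \<subseteq> tp_zeros P"
    by (simp add: tp_zeros_mult)
  have "tp_zeros Q = {}"
  proof (rule ccontr)
    assume "tp_zeros Q \<noteq> {}"
    then obtain w where w: "w \<in> tp_zeros Q" "w \<in> tp_zeros P" "w \<noteq> 0" "norm w \<noteq> 1"
      using zeros P tp_zeros_nonzero nowhere_zero_iff by blast
    then have "circle_dist_sq w dvd 1"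
      using coprime by (simp add: circle_dist_sq_dvd_iff)
    then show False
      using in_tp_zeros_circle_dist_sq[OF w(3)] tp_is_unit_iff by blast
  qed
  then show ?thesis
    using that by (rule tp_zeros_emptyE)
qed

text \<open>For nowhere vanishing \<open>P\<close>, this says that \<open>x = 1 / P\<close> solves \<open>x' = A x\<^sup>3 + B x\<^sup>2\<close>.\<close>

definition reciprocal_solution :: "trig_poly \<Rightarrow> trig_poly \<Rightarrow> trig_poly \<Rightarrow> bool" where
  "reciprocal_solution A B P \<longleftrightarrow> A + B * P + P * tp_deriv P = 0"

lemma continuous_on_tp_eval [continuous_intros]:
  assumes "continuous_on S g"
  shows "continuous_on S (\<lambda>x. tp_eval f (g x))"
proof -
  have "continuous_on UNIV (tp_eval f)"
    using has_real_derivative_tp_eval by (meson DERIV_continuous_on has_field_derivative_at_within)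
  then show ?thesis
    using assms by (rule continuous_on_compose2) simp
qed

lemma invariant_curve_one_iff:
  "invariant_curve A B P 1 \<longleftrightarrow> nowhere_zero P \<and> reciprocal_solution A B P"
proof
  assume inv: "invariant_curve A B P 1"
  then show "nowhere_zero P \<and> reciprocal_solution A B P"
    using invariant_curve_imp_eq[OF inv]
    by (simp add: invariant_curve_def nowhere_zero_def reciprocal_solution_def tp_deriv_one)
      (metis add.commute add_eq_0_iff)
next
  assume P: "nowhere_zero P \<and> reciprocal_solution A B P"
  define K where "K = (\<lambda>(t, x). - tp_eval (tp_deriv P) t * x
      - tp_eval P t * (tp_eval (tp_deriv P) t + tp_eval B t) * x ^ 2)"
  have "irreducible [:1, - P:]"
    using P by (intro irreducible_linear_polyI) (simp_all add: nowhere_zero_imp_nonzero)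
  moreover have "continuous_on UNIV K"
    unfolding K_def case_prod_unfold by (intro continuous_intros)
  moreover have "abel_field A B (line_fun P 1) t x = K (t, x) * line_fun P 1 t x" for t x
  proof -
    have "tp_eval (A + B * P + P * tp_deriv P) t = 0"
      using P by (simp add: reciprocal_solution_def)
    then have A: "tp_eval A t = - tp_eval P t * (tp_eval (tp_deriv P) t + tp_eval B t)"
      by (simp add: algebra_simps)
    then show ?thesis
      by (simp add: A abel_field_line_fun tp_deriv_one K_def line_fun_def algebra_simps
          power2_eq_square power3_eq_cube)
  qed
  ultimately show "invariant_curve A B P 1"
    using P unfolding invariant_curve_def nowhere_zero_def by blast
qed

lemma curve_one_inject:
  assumes "nowhere_zero P"
  shows "curve P 1 = curve R 1 \<longleftrightarrow> P = R"
proof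
  assume eq: "curve P 1 = curve R 1"
  show "P = R"
  proof (rule trig_poly_eqI)
    fix t
    have "(t, 1 / tp_eval P t) \<in> curve P 1"
      using assms by (simp add: curve_def line_fun_def nowhere_zero_def)
    then have "(t, 1 / tp_eval P t) \<in> curve R 1"
      by (simp only: eq)
    then show "tp_eval P t = tp_eval R t"
      using assms by (simp add: curve_def line_fun_def nowhere_zero_def)
  qed
qed simp

lemma curve_scaleR: "c \<noteq> 0 \<Longrightarrow> curve (c *\<^sub>R P) (c *\<^sub>R Q) = curve P Q"
  by (simp add: curve_def line_fun_def)

lemma invariant_curveE:
  assumes inv: "invariant_curve A B P Q" and "Q \<noteq> 0"
  obtains R where "curve P Q = curve R 1" "nowhere_zero R" "reciprocal_solution A B R"
proof -
  obtain c where c: "c \<noteq> 0" "Q = c *\<^sub>R 1"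
    using invariant_curve_imp_const[OF assms] .
  define R where "R = (1 / c) *\<^sub>R P"
  have P: "P = c *\<^sub>R R"
    using c(1) by (simp add: R_def)
  have "(c ^ 3) *\<^sub>R (A + B * R + R * tp_deriv R)
      = Q * Q * (A * Q + B * P) - P * (P * tp_deriv Q - tp_deriv P * Q)"
    by (simp add: P c(2) tp_deriv_scaleR tp_deriv_one power3_eq_cube algebra_simps)
  also have "\<dots> = 0"
    using invariant_curve_imp_eq[OF inv] by simp
  finally have "(c ^ 3) *\<^sub>R (A + B * R + R * tp_deriv R) = 0" .
  then have "reciprocal_solution A B R"
    using c(1) by (simp add: reciprocal_solution_def)
  moreover have "curve P Q = curve R 1"
    using c(1) by (simp add: P c(2) curve_scaleR)
  moreover have "nowhere_zero R"
    using inv c(1) by (simp add: R_def invariant_curve_def nowhere_zero_def)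
  ultimately show ?thesis
    using that by blast
qed

lemma two_different_nontrivial_curves_one_iff:
  "two_different_nontrivial_curves A B P1 1 P2 1 \<longleftrightarrow>
    nowhere_zero P1 \<and> reciprocal_solution A B P1 \<and>
    nowhere_zero P2 \<and> reciprocal_solution A B P2 \<and> P1 \<noteq> P2"
  using curve_one_inject
  by (auto simp: two_different_nontrivial_curves_def invariant_curve_one_iff)

section \<open>Curve data\<close>

definition curve_identities ::
  "trig_poly \<Rightarrow> trig_poly \<Rightarrow> trig_poly \<Rightarrow> trig_poly \<Rightarrow> trig_poly \<Rightarrow> trig_poly \<Rightarrow> bool" where
  "curve_identities A B G Gh S1 S2 \<longleftrightarrow>
    Gh * A = G * S1 * S2 * tp_deriv (G * Gh) \<and>
    Gh * (B + tp_deriv (G * S1)) = - S2 * tp_deriv (G * Gh)"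

lemma curve_identities_iff_reciprocal_solutions:
  assumes "G \<noteq> 0" "Gh \<noteq> 0" "k \<noteq> 0" and S2: "S2 = S1 + k *\<^sub>R Gh"
  shows "curve_identities A B G Gh S1 S2 \<longleftrightarrow>
    reciprocal_solution A B (G * S1) \<and> reciprocal_solution A B (G * S2)"
proof -
  define residual where "residual P = A + B * P + P * tp_deriv P" for P
  define A_defect where "A_defect = Gh * A - G * S1 * S2 * tp_deriv (G * Gh)"
  define B_defect where "B_defect = Gh * (B + tp_deriv (G * S1)) + S2 * tp_deriv (G * Gh)"
  have "G * S2 = G * S1 + k *\<^sub>R (G * Gh)"
    by (simp add: S2 distrib_left)
  then have "residual (G * S2) - residual (G * S1) = k *\<^sub>R (G * B_defect)"
    by (simp add: residual_def B_defect_def S2 tp_deriv_add tp_deriv_scaleR algebra_simps)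
  then have diff: "residual (G * S2) - residual (G * S1) = 0 \<longleftrightarrow> B_defect = 0"
    using assms(1,3) by simp
  have "Gh * residual (G * S1) = A_defect + G * S1 * B_defect"
    by (simp add: residual_def A_defect_def B_defect_def algebra_simps)
  then have "residual (G * S1) = 0 \<longleftrightarrow> A_defect + G * S1 * B_defect = 0"
    using assms(2) by (metis mult_eq_0_iff)
  with diff have "A_defect = 0 \<and> B_defect = 0 \<longleftrightarrow> residual (G * S1) = 0 \<and> residual (G * S2) = 0"
    by auto
  moreover have "curve_identities A B G Gh S1 S2 \<longleftrightarrow> A_defect = 0 \<and> B_defect = 0"
    by (simp add: curve_identities_def A_defect_def B_defect_def eq_neg_iff_add_eq_0)
  ultimately show ?thesis
    by (simp add: reciprocal_solution_def residual_def)
qed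

lemma curve_formulas_iff:
  fixes A B G Gh S1 S2 :: trig_poly
  assumes Gh: "tp_eval Gh t \<noteq> 0"
  defines "R \<equiv> deriv (tp_eval G) t + tp_eval G t * deriv (tp_eval Gh) t / tp_eval Gh t"
  shows "tp_eval A t = tp_eval G t * tp_eval S1 t * tp_eval S2 t * R \<longleftrightarrow>
      tp_eval (Gh * A) t = tp_eval (G * S1 * S2 * tp_deriv (G * Gh)) t"
    and "tp_eval B t = - deriv (\<lambda>s. tp_eval G s * tp_eval S1 s) t - tp_eval S2 t * R \<longleftrightarrow>
      tp_eval (Gh * (B + tp_deriv (G * S1))) t = tp_eval (- S2 * tp_deriv (G * Gh)) t"
proof -
  have R: "tp_eval (tp_deriv (G * Gh)) t = tp_eval Gh t * R"
    using Gh by (simp add: R_def deriv_tp_eval tp_deriv_mult field_simps)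
  show "tp_eval A t = tp_eval G t * tp_eval S1 t * tp_eval S2 t * R \<longleftrightarrow>
      tp_eval (Gh * A) t = tp_eval (G * S1 * S2 * tp_deriv (G * Gh)) t"
    using Gh by (simp add: R mult_ac)
  have "tp_eval (Gh * (B + tp_deriv (G * S1))) t = tp_eval (- S2 * tp_deriv (G * Gh)) t \<longleftrightarrow>
      tp_eval Gh t * tp_eval (B + tp_deriv (G * S1)) t = tp_eval Gh t * (- tp_eval S2 t * R)"
    by (simp only: tp_eval_simps R mult_ac)
  also have "\<dots> \<longleftrightarrow> tp_eval B t = - tp_eval (tp_deriv (G * S1)) t - tp_eval S2 t * R"
    using Gh by (simp only: mult_cancel_left tp_eval_simps mult_minus_left simp_thms) linarith
  finally show "tp_eval B t = - deriv (\<lambda>s. tp_eval G s * tp_eval S1 s) t - tp_eval S2 t * R \<longleftrightarrow>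
      tp_eval (Gh * (B + tp_deriv (G * S1))) t = tp_eval (- S2 * tp_deriv (G * Gh)) t"
    by (simp only: deriv_tp_eval flip: tp_eval_mult_fun)
qed

text \<open>
  The identities are compared off the zeros of \<open>Gh\<close> only: that \<open>Gh\<close> has no real zeros would need
  its factorization into irreducible elements.
\<close>

lemma curve_data_imp_identities:
  assumes "curve_data A B G Gh S1 k"
  shows "curve_identities A B G Gh S1 (S1 + k *\<^sub>R Gh)"
  unfolding curve_identities_def
proof (intro conjI; rule trig_poly_eqI_off_zeros)
  fix t
  assume "tp_eval Gh t \<noteq> 0"
  note iffs = curve_formulas_iff[OF this, of _ G S1 "S1 + k *\<^sub>R Gh"]
  show "tp_eval (Gh * A) t = tp_eval (G * S1 * (S1 + k *\<^sub>R Gh) * tp_deriv (G * Gh)) t"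
    and "tp_eval (Gh * (B + tp_deriv (G * S1))) t
      = tp_eval (- (S1 + k *\<^sub>R Gh) * tp_deriv (G * Gh)) t"
    using assms unfolding curve_data_def iffs[symmetric] by simp_all
qed (use assms in \<open>simp_all add: curve_data_def\<close>)

lemma curve_dataI:
  assumes "nowhere_zero G" "nowhere_zero S1" "nowhere_zero (S1 + k *\<^sub>R Gh)" "nowhere_zero Gh"
    and "k \<noteq> 0" "tp_zeros Gh \<subseteq> tp_zeros G"
    and "curve_identities A B G Gh S1 (S1 + k *\<^sub>R Gh)"
  shows "curve_data A B G Gh S1 k"
proof -
  have "tp_eval Gh t \<noteq> 0" for t
    using assms(4) by (simp add: nowhere_zero_def)
  note iffs = curve_formulas_iff[OF this, of _ _ G S1 "S1 + k *\<^sub>R Gh", unfolded tp_eval_simps(3,7)]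
  have "\<forall>q. irreducible q \<and> q dvd Gh \<longrightarrow> q dvd G"
    using assms(1,6) irreducible_dvd_if_tp_zeros_subset by blast
  then show ?thesis
    using assms nowhere_zero_imp_nonzero[OF assms(4)]
    unfolding curve_data_def iffs by (simp add: nowhere_zero_def curve_identities_def)
qed

lemma curve_data_imp_curves:
  assumes data: "curve_data A B G Gh S1 k"
  shows "two_different_nontrivial_curves A B (G * S1) 1 (G * (S1 + k *\<^sub>R Gh)) 1"
proof -
  have nowhere_zero: "nowhere_zero G" "nowhere_zero S1" "nowhere_zero (S1 + k *\<^sub>R Gh)"
    and nonzero: "Gh \<noteq> 0" "k \<noteq> 0"
    using data by (simp_all add: curve_data_def nowhere_zero_def)
  have "G \<noteq> 0"
    using nowhere_zero(1) by (rule nowhere_zero_imp_nonzero)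
  then have "reciprocal_solution A B (G * S1)" "reciprocal_solution A B (G * (S1 + k *\<^sub>R Gh))"
    using curve_data_imp_identities[OF data] nonzero
    by (simp_all add: curve_identities_iff_reciprocal_solutions)
  moreover have "G * S1 \<noteq> G * (S1 + k *\<^sub>R Gh)"
    using \<open>G \<noteq> 0\<close> nonzero by simp
  ultimately show ?thesis
    using nowhere_zero by (simp add: two_different_nontrivial_curves_one_iff nowhere_zero_mult)
qed

lemma reciprocal_solutions_imp_curve_data:
  assumes "nowhere_zero P1" "nowhere_zero P2" "P1 \<noteq> P2"
    and "reciprocal_solution A B P1" "reciprocal_solution A B P2"
  obtains G Gh S1 where "curve_data A B G Gh S1 1" "P1 = G * S1" "P2 = G * (S1 + Gh)"
proof -
  obtain G S1 S2 where P: "P1 = G * S1" "P2 = G * S2" and coprime: "tp_zeros S1 \<inter> tp_zeros S2 = {}"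
    using coprime_zeros_factorization[OF assms(1)] .
  define Gh where "Gh = S2 - S1"
  have S2: "S2 = S1 + Gh"
    by (simp add: Gh_def)
  have nowhere_zero: "nowhere_zero G" "nowhere_zero S1" "nowhere_zero S2"
    using assms(1,2) by (simp_all add: P nowhere_zero_mult)
  have nonzero: "G \<noteq> 0" "Gh \<noteq> 0"
    using assms(3) nowhere_zero_imp_nonzero[OF nowhere_zero(1)] by (auto simp: P Gh_def)
  have identities: "curve_identities A B G Gh S1 S2"
    using assms(4,5) nonzero
    by (simp add: P S2 curve_identities_iff_reciprocal_solutions[where k = 1])
  have "(S2 * G) * tp_deriv Gh = S2 * tp_deriv (G * Gh) - Gh * (S2 * tp_deriv G)"
    by (simp add: tp_deriv_mult algebra_simps)
  also have "S2 * tp_deriv (G * Gh) = - (Gh * (B + tp_deriv (G * S1)))"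
    using identities by (simp add: curve_identities_def)
  finally have "Gh dvd (S2 * G) * tp_deriv Gh"
    by simp
  then have "tp_zeros Gh \<subseteq> tp_zeros (S2 * G)"
    using nonzero(2) by (rule tp_zeros_subset_if_dvd_mult_tp_deriv)
  moreover have "tp_zeros Gh \<inter> tp_zeros S2 \<subseteq> tp_zeros S1"
    using tp_zeros_diff[of S2 Gh] by (auto simp: Gh_def)
  ultimately have zeros: "tp_zeros Gh \<subseteq> tp_zeros G"
    using coprime by (auto simp: tp_zeros_mult)
  then have "nowhere_zero Gh"
    using nowhere_zero(1) by (auto simp: nowhere_zero_iff)
  then have "curve_data A B G Gh S1 1"
    using nowhere_zero zeros identities by (intro curve_dataI) (simp_all flip: S2)
  then show ?thesis
    using that P unfolding S2 by blast
qed

lemma curves_imp_curve_data: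
  assumes "two_different_nontrivial_curves A B P1 Q1 P2 Q2"
  obtains G Gh S1 where "curve_data A B G Gh S1 1"
    "curve P1 Q1 = curve (G * S1) 1" "curve P2 Q2 = curve (G * (S1 + Gh)) 1"
proof -
  obtain R1 R2 where R: "curve P1 Q1 = curve R1 1" "nowhere_zero R1" "reciprocal_solution A B R1"
    "curve P2 Q2 = curve R2 1" "nowhere_zero R2" "reciprocal_solution A B R2"
    using assms invariant_curveE unfolding two_different_nontrivial_curves_def by metis
  moreover have "R1 \<noteq> R2"
    using assms R(1,4) by (auto simp: two_different_nontrivial_curves_def)
  ultimately show ?thesis
    using that by (metis reciprocal_solutions_imp_curve_data)
qed

theorem proposition2p10:
  fixes A B :: trig_poly
  shows "((\<exists>P1 Q1 P2 Q2. two_different_nontrivial_curves A B P1 Q1 P2 Q2)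
            \<longleftrightarrow> (\<exists>G Gh S1 k. curve_data A B G Gh S1 k))
       \<and> (\<forall>G Gh S1 k. curve_data A B G Gh S1 k \<longrightarrow>
            two_different_nontrivial_curves A B (G * S1) 1 (G * (S1 + k *\<^sub>R Gh)) 1)
       \<and> (\<forall>P1 Q1 P2 Q2. two_different_nontrivial_curves A B P1 Q1 P2 Q2 \<longrightarrow>
            (\<exists>G Gh S1 k. curve_data A B G Gh S1 k
               \<and> curve P1 Q1 = curve (G * S1) 1
               \<and> curve P2 Q2 = curve (G * (S1 + k *\<^sub>R Gh)) 1))"
proof -
  have "\<exists>G Gh S1 k. curve_data A B G Gh S1 k \<and> curve P1 Q1 = curve (G * S1) 1
      \<and> curve P2 Q2 = curve (G * (S1 + k *\<^sub>R Gh)) 1"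
    if "two_different_nontrivial_curves A B P1 Q1 P2 Q2" for P1 Q1 P2 Q2
    using curves_imp_curve_data[OF that] by (metis scaleR_one)
  then show ?thesis
    using curve_data_imp_curves by blast
qed

end
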